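(* Let $D>0$, $h>0$, $R_{th}\ge 0$, and put $C_{th}=2^{R_{th}}$. Let $x_1,y_1,x_2,y_2$ be independent random variables, each uniformly distributed on $[-\frac D2,\frac D2]$. For $\bar\gamma>0$ let $$\gamma_B=\frac{\bar\gamma}{y_1^2+h^2},\qquad \gamma_E=\frac{\bar\gamma}{(x_1-x_2)^2+y_2^2+h^2},\qquad \mathcal P_{so}(\bar\gamma)=\mathrm{Pr}\left(\log_2(1+\gamma_B)-\log_2(1+\gamma_E)\le R_{th}\right).$$ Let $F_\chi$ denote the cumulative distribution function of $\chi=(x_1-x_2)^2+y_2^2$. Then $$\lim_{\bar\gamma\to\infty}\mathcal P_{so}(\bar\gamma)=\frac2D\int_0^{D/2}F_\chi\left(C_{th}(t^2+h^2)-h^2\right)dt .$$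
   Context: Setting: a base station serves a legitimate user (Bob) at $(x_1,y_1,0)$ in the presence of an eavesdropper (Eve) at $(x_2,y_2,0)$, using a pinching antenna on a waveguide at height $h$ activated at $(x_1,0,h)$, the point of the waveguide closest to Bob. $\gamma_B$ and $\gamma_E$ are the signal-to-noise ratios at Bob and Eve, $\bar\gamma=\eta P_s/\sigma^2$ is the effective transmit SNR (with $P_s$ the transmit power, and $\eta,\sigma^2>0$ fixed), $R_{th}$ is the target secrecy rate, and $\mathcal P_{so}$ is the secrecy outage probability (SOP). The high transmit SNR regime is $P_s\to\infty$, i.e. $\bar\gamma\to\infty$. *)

theory Defs
  imports "HOL-Probability.Probability"
begin

text \<open>
  The pinching antenna is activated at \<open>(x\<^sub>1, 0, h)\<close>; Bob sits at \<open>(x\<^sub>1, y\<^sub>1, 0)\<close>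
  and Eve at \<open>(x\<^sub>2, y\<^sub>2, 0)\<close>. The denominators below are the squared distances
  from the antenna, and \<open>\<gamma>\<close> is the effective transmit SNR.
\<close>

definition snr_Bob :: "real \<Rightarrow> real \<Rightarrow> real \<Rightarrow> real" where
  "snr_Bob h \<gamma> y1 = \<gamma> / (y1\<^sup>2 + h\<^sup>2)"

definition snr_Eve :: "real \<Rightarrow> real \<Rightarrow> real \<Rightarrow> real \<Rightarrow> real \<Rightarrow> real" where
  "snr_Eve h \<gamma> x1 x2 y2 = \<gamma> / ((x1 - x2)\<^sup>2 + y2\<^sup>2 + h\<^sup>2)"

definition secrecy_outage_prob ::
    "'a measure \<Rightarrow> ('a \<Rightarrow> real) \<Rightarrow> ('a \<Rightarrow> real) \<Rightarrow> ('a \<Rightarrow> real) \<Rightarrow> ('a \<Rightarrow> real) \<Rightarrow>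
      real \<Rightarrow> real \<Rightarrow> real \<Rightarrow> real" where
  "secrecy_outage_prob M x1 y1 x2 y2 h R \<gamma> =
     \<P>(\<omega> in M. log 2 (1 + snr_Bob h \<gamma> (y1 \<omega>))
             - log 2 (1 + snr_Eve h \<gamma> (x1 \<omega>) (x2 \<omega>) (y2 \<omega>)) \<le> R)"

definition uniform_rv :: "'a measure \<Rightarrow> ('a \<Rightarrow> real) \<Rightarrow> real \<Rightarrow> real \<Rightarrow> bool" where
  "uniform_rv M X a b \<longleftrightarrow>
     distributed M lborel X (\<lambda>x. ennreal (indicator {a..b} x / measure lborel {a..b}))"

end

theory Submission
  imports Defs
begin

text \<open>
  Write \<open>a = y\<^sub>1\<^sup>2 + h\<^sup>2\<close> and \<open>b = \<chi> + h\<^sup>2\<close>. Outage at SNR \<open>\<gamma>\<close> means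
  \<open>1 / a - C / b \<le> (C - 1) / \<gamma>\<close>. Since \<open>C \<ge> 1\<close>, the indicator of this event converges at every
  sample point, the boundary \<open>b = C a\<close> included, to that of \<open>b \<le> C a\<close>. Bounded convergence gives
  the limit \<open>Pr (\<chi> \<le> C (y\<^sub>1\<^sup>2 + h\<^sup>2) - h\<^sup>2)\<close>; conditioning on \<open>y\<^sub>1\<close>, which is independent of \<open>\<chi>\<close>,
  turns it into the integral of \<open>F\<^sub>\<chi>\<close>, whose integrand is even.
\<close>

text \<open>Exponentiating and then dividing by \<open>g\<close> separates the variables: the
  geometry stays on the left, and the SNR enters only through a threshold that vanishes as
  \<open>g\<close> grows.\<close>

lemma log_secrecy_rate_le_iff:
  fixes R a b g :: real
  assumes "a > 0" "b > 0" "g > 0"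
  shows "log 2 (1 + g / a) - log 2 (1 + g / b) \<le> R \<longleftrightarrow>
         1 / a - 2 powr R / b \<le> (2 powr R - 1) / g"
proof -
  have pos: "1 + g / a > 0" "1 + g / b > 0"
    using assms by (simp_all add: add_pos_pos)
  have "log 2 (1 + g / a) - log 2 (1 + g / b) \<le> R \<longleftrightarrow>
        log 2 (1 + g / a) \<le> log 2 (2 powr R * (1 + g / b))"
    using pos by (auto simp: log_mult)
  also have "\<dots> \<longleftrightarrow> 1 + g / a \<le> 2 powr R * (1 + g / b)"
    using pos by (subst log_le_cancel_iff) auto
  also have "\<dots> \<longleftrightarrow> 1 / a - 2 powr R / b \<le> (2 powr R - 1) / g"
    using assms by (simp add: field_simps)
  finally show ?thesis .
qed

text \<open>The threshold \<open>(2 powr R - 1) / g\<close> tends to 0 and, because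
  \<open>R \<ge> 0\<close>, never drops below 0 for positive \<open>g\<close>. So
  \<open>d \<le> 0\<close>, with the boundary \<open>d = 0\<close>, satisfies it for every
  \<open>g > 0\<close>, while a fixed \<open>d > 0\<close> eventually exceeds it.\<close>

lemma eventually_log_secrecy_rate_le_iff:
  fixes R a b :: real
  assumes "a > 0" "b > 0" "R \<ge> 0"
  shows "\<forall>\<^sub>F g in at_top. log 2 (1 + g / a) - log 2 (1 + g / b) \<le> R \<longleftrightarrow> b \<le> 2 powr R * a"
proof -
  define d where "d = 1 / a - 2 powr R / b"
  have d: "d \<le> 0 \<longleftrightarrow> b \<le> 2 powr R * a"
    using assms by (simp add: d_def field_simps)
  have R: "2 powr R \<ge> 1"
    using assms by (simp add: ge_one_powr_ge_zero)
  have "\<forall>\<^sub>F g in at_top. d \<le> (2 powr R - 1) / g \<longleftrightarrow> d \<le> 0"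
  proof (cases "d \<le> 0")
    case True
    show ?thesis
      using eventually_gt_at_top[of 0]
    proof eventually_elim
      case (elim g)
      then have "0 \<le> (2 powr R - 1) / g"
        using R by simp
      then show ?case
        using True by linarith
    qed
  next
    case False
    have "((\<lambda>g. (2 powr R - 1) / g) \<longlongrightarrow> 0) at_top"
      by (intro real_tendsto_divide_at_top[OF tendsto_const] filterlim_ident)
    then have "\<forall>\<^sub>F g in at_top. (2 powr R - 1) / g < d"
      by (rule order_tendstoD) (use False in simp)
    then show ?thesis
      by eventually_elim (use False in simp)
  qed
  with eventually_gt_at_top[of 0] show ?thesis
    by eventually_elim (use assms d in \<open>simp add: log_secrecy_rate_le_iff d_def\<close>)
qed

text \<open>Each indicator is eventually constant in \<open>g\<close>, from a point that may depend
  on \<open>\<omega>\<close>. The constant 1 dominates and is integrable over a finite measure, so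
  no uniformity in \<open>\<omega>\<close> is required.\<close>

lemma (in finite_measure) tendsto_measure_eventually:
  fixes P :: "real \<Rightarrow> 'a \<Rightarrow> bool"
  assumes [measurable]: "\<And>g. Measurable.pred M (P g)" "Measurable.pred M Q"
    and ev: "\<And>\<omega>. \<omega> \<in> space M \<Longrightarrow> \<forall>\<^sub>F g in at_top. P g \<omega> \<longleftrightarrow> Q \<omega>"
  shows "((\<lambda>g. \<P>(\<omega> in M. P g \<omega>)) \<longlongrightarrow> \<P>(\<omega> in M. Q \<omega>)) at_top"
proof -
  have "((\<lambda>g. \<integral>\<omega>. indicat_real {\<omega> \<in> space M. P g \<omega>} \<omega> \<partial>M) \<longlongrightarrow>
         (\<integral>\<omega>. indicat_real {\<omega> \<in> space M. Q \<omega>} \<omega> \<partial>M)) at_top"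
  proof (rule integral_dominated_convergence_at_top[where w = "\<lambda>_. 1"])
    show "AE \<omega> in M. ((\<lambda>g. indicat_real {\<omega> \<in> space M. P g \<omega>} \<omega>) \<longlongrightarrow>
            indicat_real {\<omega> \<in> space M. Q \<omega>} \<omega>) at_top"
    proof (rule AE_I2)
      fix \<omega> assume "\<omega> \<in> space M"
      from ev[OF this] show "((\<lambda>g. indicat_real {\<omega> \<in> space M. P g \<omega>} \<omega>) \<longlongrightarrow>
            indicat_real {\<omega> \<in> space M. Q \<omega>} \<omega>) at_top"
        by (intro tendsto_eventually) (auto elim!: eventually_mono simp: indicator_def)
    qed
  qed (auto simp: indicator_def)
  then show ?thesis
    by (simp add: Int_def conj_commute cong: conj_cong)
qed

text \<open>Independence makes the joint law a product. By Tonelli, the mass of the region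
  \<open>A\<close> is the average over \<open>x\<close> of the mass of its sections, and the section
  at \<open>x\<close> is the half-line \<open>{..g x}\<close>.\<close>

lemma (in prob_space) prob_le_indep_eq_expectation_cdf:
  fixes X Y :: "'a \<Rightarrow> real" and g :: "real \<Rightarrow> real"
  assumes indep: "indep_var borel X borel Y" and [measurable]: "g \<in> borel_measurable borel"
  shows "\<P>(\<omega> in M. Y \<omega> \<le> g (X \<omega>)) = expectation (\<lambda>\<omega>. cdf (distr M borel Y) (g (X \<omega>)))"
proof -
  have [measurable]: "random_variable borel X" "random_variable borel Y"
    using indep by (auto dest: indep_var_rv1 indep_var_rv2)
  interpret Y: real_distribution "distr M borel Y"
    by (rule real_distribution_distr) simp
  \<comment> \<open>A cdf may jump, so measurability comes from monotonicity.\<close>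
  have [measurable]: "cdf (distr M borel Y) \<in> borel_measurable borel"
    by (intro borel_measurable_mono monoI Y.cdf_nondecreasing)
  define A :: "(real \<times> real) set" where "A = {p \<in> space (borel \<Otimes>\<^sub>M borel). snd p \<le> g (fst p)}"
  have [measurable]: "A \<in> sets (borel \<Otimes>\<^sub>M borel)"
    unfolding A_def by measurable
  have "emeasure M {\<omega> \<in> space M. Y \<omega> \<le> g (X \<omega>)} =
        emeasure (distr M (borel \<Otimes>\<^sub>M borel) (\<lambda>\<omega>. (X \<omega>, Y \<omega>))) A"
    by (subst emeasure_distr, simp, simp)
      (auto simp: A_def space_pair_measure intro!: arg_cong[where f = "emeasure M"])
  also have "\<dots> = emeasure (distr M borel X \<Otimes>\<^sub>M distr M borel Y) A"
    using indep by (simp add: indep_var_distribution_eq)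
  also have "\<dots> = (\<integral>\<^sup>+ x. emeasure (distr M borel Y) (Pair x -` A) \<partial>distr M borel X)"
    by (rule Y.emeasure_pair_measure_alt) (simp cong: sets_pair_measure_cong)
  also have "\<dots> = (\<integral>\<^sup>+ x. ennreal (cdf (distr M borel Y) (g x)) \<partial>distr M borel X)"
    by (intro nn_integral_cong)
      (auto simp: A_def space_pair_measure cdf_def Y.emeasure_eq_measure vimage_def atMost_def)
  also have "\<dots> = (\<integral>\<^sup>+ \<omega>. ennreal (cdf (distr M borel Y) (g (X \<omega>))) \<partial>M)"
    by (subst nn_integral_distr) auto
  also have "\<dots> = ennreal (expectation (\<lambda>\<omega>. cdf (distr M borel Y) (g (X \<omega>))))"
    by (intro nn_integral_eq_integral integrable_const_bound[where B = 1])
      (auto simp: Y.cdf_nonneg Y.cdf_bounded_prob)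
  finally show ?thesis
    by (simp add: emeasure_eq_measure integral_nonneg_AE Y.cdf_nonneg)
qed

lemma set_integral_even_interval:
  fixes f :: "real \<Rightarrow> real"
  assumes int: "set_integrable lborel {-a..a} f" and even: "\<And>t. f (- t) = f t" and "a \<ge> 0"
  shows "(LBINT t:{-a..a}. f t) = 2 * (LBINT t:{0..a}. f t)"
proof -
  have "(LBINT t:{-a..a}. f t) = (LBINT t:{-a..0} \<union> {0..a}. f t)"
    using \<open>a \<ge> 0\<close> by (simp add: ivl_disj_un_two_touch)
  also have "\<dots> = (LBINT t:{-a..0}. f t) + (LBINT t:{0..a}. f t)"
  proof (rule set_integral_Un_AE)
    \<comment> \<open>The two closed halves share the point 0, so they are disjoint only up to a
      null set.\<close>
    show "AE t in lborel. \<not> (t \<in> {-a..0} \<and> t \<in> {0..a})"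
      using AE_lborel_singleton[of 0] by eventually_elim auto
  qed (use \<open>a \<ge> 0\<close> in \<open>auto intro: set_integrable_subset[OF int]\<close>)
  also have "(LBINT t:{-a..0}. f t) = (LBINT t:{0..a}. f t)"
    \<comment> \<open>Substitute \<open>-t\<close> for \<open>t\<close>: the Jacobian has absolute
      value 1, and the reflection swaps the two halves.\<close>
    unfolding set_lebesgue_integral_def
    by (subst lborel_integral_real_affine[where c = "-1" and t = 0])
      (auto simp: even indicator_def intro!: Bochner_Integration.integral_cong)
  finally show ?thesis
    by simp
qed

lemma (in prob_space) expectation_uniform_rv:
  fixes X :: "'a \<Rightarrow> real" and f :: "real \<Rightarrow> real"
  assumes "uniform_rv M X a b" "f \<in> borel_measurable borel" "a \<le> b"
  shows "expectation (\<lambda>\<omega>. f (X \<omega>)) = (LBINT t:{a..b}. f t) / (b - a)"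
proof -
  have "expectation (\<lambda>\<omega>. f (X \<omega>)) = (\<integral>t. indicator {a..b} t / measure lborel {a..b} * f t \<partial>lborel)"
    by (rule distributed_integral[symmetric])
      (use assms in \<open>auto simp: uniform_rv_def\<close>)
  also have "\<dots> = (LBINT t:{a..b}. f t) / (b - a)"
    using \<open>a \<le> b\<close> by (simp add: set_lebesgue_integral_def)
  finally show ?thesis .
qed

theorem corollary1:
  fixes M :: "'a measure"
    and x1 y1 x2 y2 chi :: "'a \<Rightarrow> real"
    and D h R_th C_th :: real
    and F_chi :: "real \<Rightarrow> real"
  assumes "prob_space M"
    and "D > 0" and "h > 0" and "R_th \<ge> 0"
    and "C_th = 2 powr R_th"
    and "prob_space.indep_vars M (\<lambda>_. borel) (\<lambda>i. [x1, y1, x2, y2] ! i) {..<4}"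
    and "uniform_rv M x1 (- (D / 2)) (D / 2)"
    and "uniform_rv M y1 (- (D / 2)) (D / 2)"
    and "uniform_rv M x2 (- (D / 2)) (D / 2)"
    and "uniform_rv M y2 (- (D / 2)) (D / 2)"
    and "chi = (\<lambda>\<omega>. (x1 \<omega> - x2 \<omega>)\<^sup>2 + (y2 \<omega>)\<^sup>2)"
    and "F_chi = cdf (distr M borel chi)"
  shows "((\<lambda>\<gamma>. secrecy_outage_prob M x1 y1 x2 y2 h R_th \<gamma>) \<longlongrightarrow>
            2 / D * (LBINT t:{0..D / 2}. F_chi (C_th * (t\<^sup>2 + h\<^sup>2) - h\<^sup>2))) at_top"
proof -
  interpret prob_space M by fact
  define a where "a = D / 2"
  \<comment> \<open>The limiting event compares squared distances; moving Eve's
    \<open>h\<^sup>2\<close> to the other side leaves \<open>chi\<close> alone on the left.\<close>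
  define G where "G t = C_th * (t\<^sup>2 + h\<^sup>2) - h\<^sup>2" for t
  have rv [measurable]: "x1 \<in> borel_measurable M" "y1 \<in> borel_measurable M"
      "x2 \<in> borel_measurable M" "y2 \<in> borel_measurable M"
    using assms(7-10) by (auto simp: uniform_rv_def dest: distributed_measurable)
  have [measurable]: "chi \<in> borel_measurable M"
    unfolding assms(11) by measurable
  have [measurable]: "G \<in> borel_measurable borel"
    unfolding G_def by measurable
  interpret chi: real_distribution "distr M borel chi"
    by (rule real_distribution_distr) simp
  have [measurable]: "F_chi \<in> borel_measurable borel"
    unfolding assms(12) by (intro borel_measurable_mono monoI chi.cdf_nondecreasing)
  have bound: "\<bar>F_chi t\<bar> \<le> 1" for t
    unfolding assms(12) using chi.cdf_nonneg[of t] chi.cdf_bounded_prob[of t] by simp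
  have indep: "indep_var borel y1 borel chi"
  proof -
    let ?X = "\<lambda>i. [x1, y1, x2, y2] ! i"
    \<comment> \<open>Disjoint blocks of an independent family are independent: index 1 is
      \<open>y1\<close>, and \<open>chi\<close> is a measurable function of the block 0, 2, 3, that
      is of \<open>x1\<close>, \<open>x2\<close>, \<open>y2\<close>.\<close>
    have "indep_var (PiM {1} (\<lambda>_. borel)) (\<lambda>\<omega>. restrict (\<lambda>i. ?X i \<omega>) {1})
        (PiM {0, 2, 3} (\<lambda>_. borel)) (\<lambda>\<omega>. restrict (\<lambda>i. ?X i \<omega>) {0, 2, 3})"
      by (rule indep_var_restrict[OF assms(6)]) auto
    then have "indep_var borel ((\<lambda>v. v 1) \<circ> (\<lambda>\<omega>. restrict (\<lambda>i. ?X i \<omega>) {1}))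
        borel ((\<lambda>v. (v 0 - v 2)\<^sup>2 + (v 3)\<^sup>2) \<circ> (\<lambda>\<omega>. restrict (\<lambda>i. ?X i \<omega>) {0, 2, 3}))"
      by (rule indep_var_compose) measurable
    then show ?thesis
      by (simp add: assms(11) comp_def numeral_3_eq_3 numeral_2_eq_2)
  qed
  have "((\<lambda>\<gamma>. secrecy_outage_prob M x1 y1 x2 y2 h R_th \<gamma>) \<longlongrightarrow> \<P>(\<omega> in M. chi \<omega> \<le> G (y1 \<omega>))) at_top"
    unfolding secrecy_outage_prob_def snr_Bob_def snr_Eve_def
  proof (rule tendsto_measure_eventually)
    fix \<omega>
    \<comment> \<open>The height keeps both squared distances positive at every sample point, even
      when a user is directly below the antenna.\<close>
    have "h\<^sup>2 > 0"
      using \<open>h > 0\<close> by simp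
    then have "(y1 \<omega>)\<^sup>2 + h\<^sup>2 > 0" "(x1 \<omega> - x2 \<omega>)\<^sup>2 + (y2 \<omega>)\<^sup>2 + h\<^sup>2 > 0"
      by (simp_all add: add_nonneg_pos)
    from eventually_log_secrecy_rate_le_iff[OF this \<open>R_th \<ge> 0\<close>]
    show "\<forall>\<^sub>F \<gamma> in at_top. (log 2 (1 + \<gamma> / ((y1 \<omega>)\<^sup>2 + h\<^sup>2)) -
        log 2 (1 + \<gamma> / ((x1 \<omega> - x2 \<omega>)\<^sup>2 + (y2 \<omega>)\<^sup>2 + h\<^sup>2)) \<le> R_th) = (chi \<omega> \<le> G (y1 \<omega>))"
      by (simp add: G_def assms(5,11) le_diff_eq)
  qed measurable
  also have "\<P>(\<omega> in M. chi \<omega> \<le> G (y1 \<omega>)) = expectation (\<lambda>\<omega>. F_chi (G (y1 \<omega>)))"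
    unfolding assms(12) by (rule prob_le_indep_eq_expectation_cdf[OF indep]) simp
  also have "\<dots> = (LBINT t:{-a..a}. F_chi (G t)) / D"
    using expectation_uniform_rv[OF assms(8), of "\<lambda>t. F_chi (G t)"] \<open>D > 0\<close>
    by (simp add: a_def)
  \<comment> \<open>\<open>G\<close> depends on \<open>t\<close> only through
    \<open>t\<^sup>2\<close>, so the integrand is even; it is integrable because a cdf is bounded by
    1 and the interval has finite length.\<close>
  also have "(LBINT t:{-a..a}. F_chi (G t)) = 2 * (LBINT t:{0..a}. F_chi (G t))"
  proof (rule set_integral_even_interval)
    show "set_integrable lborel {-a..a} (\<lambda>t. F_chi (G t))"
      unfolding set_integrable_def
      by (rule integrableI_bounded_set_indicator[where B = 1])
        (auto simp: assms(12)[symmetric] emeasure_lborel_Icc_eq bound)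
  qed (use \<open>D > 0\<close> in \<open>auto simp: G_def a_def\<close>)
  finally show ?thesis
    by (simp add: G_def a_def)
qed

end
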